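(* Let $t$ be a positive integer. (a) If $t(t+1)$ is not of the form $3l(l+1)$ for any $l\in\mathbb{N}$, then the interval $[4t+1,\,2t(t+1)+1]$ contains an integer $n\equiv 1\pmod 4$ with $b_3^+(n)$ odd. (b) If $2t(2t+1)$ is not of the form $3l(l+1)$ for any $l\in\mathbb{N}$, then the interval $[8t+1,\,4t(2t+1)+1]$ contains an integer $n\equiv 1\pmod 4$ with $b_3^+(n)$ even. In particular, there are infinitely many integers $n\equiv 1\pmod 4$ for which $c_3^+(n)$ is even, and infinitely many integers $n\equiv 1\pmod 4$ for which $c_3^+(n)$ is odd.
   Context: Let $q=e^{2\pi i z}$ with $z$ in the upper half-plane, and $\eta(z)=q^{1/24}\prod_{n\ge1}(1-q^n)$. Define $g_3^+(z)=\left(\frac{\eta(3z)}{\eta(z)}\right)^{12}=\sum_{n\ge 1}b_3^+(n)q^n$ (so $b_3^+(n)=0$ for $n<1$). Define $j_3^+(z)=\left(\frac{\eta(z)}{\eta(3z)}\right)^{12}+12+3^6\left(\frac{\eta(3z)}{\eta(z)}\right)^{12}$ and let $c_3^+(n)$ be the coefficient of $q^n$ in its $q$-expansion. *)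

theory Defs
  imports "HOL-Complex_Analysis.Complex_Analysis" "HOL-Number_Theory.Cong"
begin

definition nome :: "complex \<Rightarrow> complex" where
  "nome z = exp (2 * of_real pi * \<i> * z)"

text \<open>The factor \<open>q\<^sup>1\<^sup>/\<^sup>2\<^sup>4\<close> is read as \<open>exp (2 \<pi> i z / 24)\<close>, not as a principal root of \<open>q\<close>.\<close>
definition dedekind_eta :: "complex \<Rightarrow> complex" where
  "dedekind_eta z = exp (2 * of_real pi * \<i> * z / 24) * (\<Prod>n. 1 - nome z ^ Suc n)"

definition g3plus :: "complex \<Rightarrow> complex" where
  "g3plus z = (dedekind_eta (3 * z) / dedekind_eta z) ^ 12"

definition j3plus :: "complex \<Rightarrow> complex" where
  "j3plus z = (dedekind_eta z / dedekind_eta (3 * z)) ^ 12 + 12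
     + 3 ^ 6 * (dedekind_eta (3 * z) / dedekind_eta z) ^ 12"

text \<open>A \<open>q\<close>-expansion, with finite principal part, on the whole upper half-plane.\<close>
definition has_q_expansion :: "(complex \<Rightarrow> complex) \<Rightarrow> (int \<Rightarrow> complex) \<Rightarrow> bool" where
  "has_q_expansion f a \<longleftrightarrow>
     (\<exists>N. \<forall>n<N. a n = 0) \<and>
     (\<forall>z. Im z > 0 \<longrightarrow> ((\<lambda>n. a n * nome z powi n) has_sum f z) UNIV)"

text \<open>
  A function has at most one \<open>q\<close>-expansion. The coefficients are taken as integers so that
  their parity makes sense; both expansions below do have integral coefficients.
\<close>
definition q_coeff :: "(complex \<Rightarrow> complex) \<Rightarrow> int \<Rightarrow> int" where
  "q_coeff f = (THE a. has_q_expansion f (\<lambda>n. of_int (a n)))"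

definition b3plus :: "int \<Rightarrow> int" where
  "b3plus = q_coeff g3plus"

definition c3plus :: "int \<Rightarrow> int" where
  "c3plus = q_coeff j3plus"

end

theory Submission
  imports Defs "HOL-Library.Z2" "HOL-Library.Nat_Bijection"
begin

text \<open>
  Modulo 2 the expansion of \<open>g\<^sub>3\<^sup>+\<close> is \<open>q\<close> times a power series in \<open>Q = q\<^sup>4\<close>: from
  \<open>(1 - x)\<^sup>1\<^sup>2 \<equiv> (1 - x\<^sup>4)\<^sup>3\<close> one gets \<open>q \<beta>(Q)\<close> with \<open>\<beta>(Q) E(Q)\<^sup>3 \<equiv> E(Q\<^sup>3)\<^sup>3\<close>, where
  \<open>E(x) = (1 - x)(1 - x\<^sup>2)(1 - x\<^sup>3)\<dots>\<close>. Since \<open>E(x)\<^sup>3\<close> is congruent to the sum \<open>\<theta>(x)\<close> of all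
  \<open>x\<close> to the power of a triangular number, \<open>\<theta>(Q) \<beta>(Q) \<equiv> \<theta>(Q\<^sup>3)\<close>. Comparing coefficients at
  the \<open>t\<close>-th triangular number \<open>T\<^sub>t\<close>, which is not three times a triangular number, the \<open>t\<close>
  coefficients of \<open>\<beta>\<close> at \<open>T\<^sub>t - T\<^sub>l\<close> for \<open>l < t\<close> have odd sum. Hence one of them is odd, and,
  if \<open>t\<close> is even, one of them is even. As \<open>1 / g\<^sub>3\<^sup>+ \<equiv> q\<^sup>-\<^sup>1 / \<beta>(Q)\<close> has only exponents
  \<open>3\<close> modulo \<open>4\<close>, the coefficients of \<open>j\<^sub>3\<^sup>+\<close> and \<open>g\<^sub>3\<^sup>+\<close> at \<open>q\<^sup>n\<close> with \<open>n \<equiv> 1\<close> modulo \<open>4\<close>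
  have the same parity.
\<close>

unbundle no vec_syntax

subsection \<open>The Euler product and triangular numbers\<close>

lemma fps_mult_nth_cong:
  assumes "\<And>j. j \<le> n \<Longrightarrow> F $ j = F' $ j" "\<And>j. j \<le> n \<Longrightarrow> G $ j = G' $ j"
  shows "(F * G) $ n = (F' * G') $ n"
  using assms by (auto simp: fps_mult_nth intro!: sum.cong)

lemma fps_power_nth_cong:
  fixes F F' :: "'a::comm_ring_1 fps"
  assumes "\<And>j. j \<le> n \<Longrightarrow> F $ j = F' $ j" "i \<le> n"
  shows "(F ^ m) $ i = (F' ^ m) $ i"
  using assms(2)
proof (induction m arbitrary: i)
  case (Suc m)
  show ?case unfolding power_Suc
    by (rule fps_mult_nth_cong) (use Suc assms in auto)
qed auto

section \<open>The Euler product as a formal power series\<close>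

definition euler_prod :: "nat \<Rightarrow> 'a::comm_ring_1 fps" where
  "euler_prod N = (\<Prod>k<N. 1 - fps_X ^ Suc k)"

text \<open>Reading coefficient \<open>n\<close> off the \<open>n\<close>-th partial product defines
  the infinite product over any commutative ring without a limit.\<close>

definition euler_fps :: "'a::comm_ring_1 fps" where
  "euler_fps = Abs_fps (\<lambda>n. euler_prod n $ n)"

text \<open>Passing from \<open>N\<close> to \<open>Suc N\<close> subtracts
  \<open>fps_X ^ Suc N\<close> times the old product, which leaves all degrees up to
  \<open>N\<close> unchanged.\<close>

lemma euler_prod_nth:
  assumes "n \<le> N"
  shows "euler_prod N $ n = euler_fps $ n"
  using assms
proof (induction N rule: dec_induct)
  case (step N)
  have "euler_prod (Suc N) = euler_prod N - fps_X ^ Suc N * (euler_prod N :: 'a fps)"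
    by (simp add: euler_prod_def algebra_simps)
  hence "(euler_prod (Suc N) :: 'a fps) $ n = euler_prod N $ n - (fps_X ^ Suc N * euler_prod N) $ n"
    by simp
  also have "(fps_X ^ Suc N * (euler_prod N :: 'a fps)) $ n = 0"
    using step.hyps unfolding fps_X_power_mult_nth by simp
  finally show ?case using step.IH by simp
qed (simp add: euler_fps_def)

lemma euler_fps_0 [simp]: "euler_fps $ 0 = 1"
  by (simp add: euler_fps_def euler_prod_def)

text \<open>The coefficientwise ring homomorphism out of the integers. With target
  \<open>complex\<close> it links integral series to analysis, with target \<open>bit\<close> it is
  reduction modulo 2.\<close>

definition fps_of_int_fps :: "int fps \<Rightarrow> 'a::comm_ring_1 fps" where
  "fps_of_int_fps F = Abs_fps (\<lambda>n. of_int (F $ n))"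

lemma fps_of_int_fps_nth [simp]: "fps_of_int_fps F $ n = of_int (F $ n)"
  by (simp add: fps_of_int_fps_def)

lemma fps_of_int_fps_1 [simp]: "fps_of_int_fps 1 = 1"
  by (auto simp: fps_eq_iff)

lemma fps_of_int_fps_diff: "fps_of_int_fps (F - G) = fps_of_int_fps F - fps_of_int_fps G"
  by (simp add: fps_eq_iff)

lemma fps_of_int_fps_mult: "fps_of_int_fps (F * G) = fps_of_int_fps F * fps_of_int_fps G"
  by (simp add: fps_eq_iff fps_mult_nth)

lemma fps_of_int_fps_power: "fps_of_int_fps (F ^ n) = fps_of_int_fps F ^ n"
  by (induction n) (simp_all add: fps_of_int_fps_mult)

lemma fps_of_int_fps_X_power: "fps_of_int_fps (fps_X ^ n) = fps_X ^ n"
  by (simp add: fps_eq_iff)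

lemma fps_of_int_euler_prod: "fps_of_int_fps (euler_prod N) = euler_prod N"
proof (induction N)
  case (Suc N)
  thus ?case
    unfolding euler_prod_def prod.lessThan_Suc
    by (simp only: fps_of_int_fps_mult fps_of_int_fps_diff fps_of_int_fps_X_power fps_of_int_fps_1)
qed (simp add: euler_prod_def)

lemma fps_of_int_euler [simp]: "fps_of_int_fps euler_fps = euler_fps"
  unfolding fps_eq_iff
  by (metis fps_of_int_euler_prod fps_of_int_fps_nth euler_prod_nth order_refl)

lemma fps_of_int_compose_X_power:
  assumes "d > 0"
  shows "fps_of_int_fps (F oo fps_X ^ d) = (fps_of_int_fps F oo fps_X ^ d :: 'a::field fps)"
  using assms by (simp add: fps_eq_iff fps_nth_compose_X_power)

text \<open>
  Shanks' finite form of Gauss's identity for the sum of all \<open>x ^ triangle j\<close>. The terms of the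
  sum on the left change by a telescoping difference when \<open>n\<close> grows by one.
\<close>
lemma sum_triangle_powers:
  fixes x :: "'a::comm_ring_1" and r :: "nat \<Rightarrow> 'a"
  assumes r: "\<And>k. (1 - x ^ (2 * k + 1)) * r k = 1"
  shows "(\<Sum>s<n. (\<Prod>k\<in>{s..<n}. (1 - x ^ (2 * k + 2)) * r k) * x ^ (s * (2 * n + 1)))
       = (\<Sum>j<2 * n. x ^ triangle j)"
proof (induction n)
  case (Suc n)
  define a where "a k = (1 - x ^ (2 * k + 2)) * r k" for k
  define Q where "Q s m = (\<Prod>k\<in>{s..<m}. a k)" for s m
  define y where "y = x ^ (2 * n + 1)"
  \<comment> \<open>\<open>U\<close> is an antidifference: \<open>tele\<close> shows that each term
    with \<open>s < n\<close> changes by \<open>U (Suc s) - U s\<close>. The common factor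
    \<open>r n\<close> arises because \<open>r n\<close> inverts \<open>1 - y\<close>.\<close>
  define U where "U s = r n * Q s n * y ^ s * (1 - x ^ (2 * s))" for s
  have tele: "Q s (Suc n) * x ^ (s * (2 * Suc n + 1)) - Q s n * y ^ s = U (Suc s) - U s"
    if "s < n" for s
  proof -
    have Q1: "Q s n = a s * Q (Suc s) n"
      using that by (simp add: Q_def prod.atLeast_Suc_lessThan)
    have Q2: "Q s (Suc n) = Q s n * a n"
      using that by (simp add: Q_def)
    have "(1 - x ^ (2 * s + 1)) * Q s n = ((1 - x ^ (2 * s + 1)) * r s) * ((1 - x ^ (2 * s + 2)) * Q (Suc s) n)"
      by (simp add: Q1 a_def mult_ac)
    hence Q3: "(1 - x ^ (2 * s + 2)) * Q (Suc s) n = (1 - x ^ (2 * s + 1)) * Q s n"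
      using r by simp
    have "U (Suc s) = r n * y ^ Suc s * ((1 - x ^ (2 * s + 2)) * Q (Suc s) n)"
      by (simp add: U_def mult_ac)
    hence U': "U (Suc s) = r n * Q s n * y ^ s * (y - y * x ^ (2 * s) * x)"
      unfolding Q3 by (simp add: algebra_simps)
    have e: "x ^ (s * (2 * Suc n + 1)) = y ^ s * x ^ (2 * s)" "x ^ (2 * n + 2) = y * x"
      by (simp_all add: y_def power_mult[symmetric] power_add[symmetric] algebra_simps)
    have "Q s n * y ^ s = Q s n * y ^ s * ((1 - y) * r n)"
      using r[of n] by (simp add: y_def)
    thus ?thesis
      unfolding U' Q2 e a_def unfolding U_def by (simp add: algebra_simps)
  qed
  have "(\<Sum>s<n. Q s (Suc n) * x ^ (s * (2 * Suc n + 1))) - (\<Sum>s<n. Q s n * y ^ s) = U n - U 0" (is "?A - _ = _")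
    unfolding sum_subtractf[symmetric] sum_lessThan_telescope[symmetric]
    by (rule sum.cong[OF refl], rule tele) simp
  moreover have "U 0 = 0" by (simp add: U_def)
  moreover have Un: "U n = r n * y ^ n * (1 - x ^ (2 * n))" by (simp add: U_def Q_def)
  moreover have "(\<Sum>s<n. Q s n * y ^ s) = (\<Sum>j<2 * n. x ^ triangle j)"
  proof -
    have "y ^ s = x ^ (s * (2 * n + 1))" for s
      unfolding y_def power_mult[symmetric] by (simp only: mult.commute)
    thus ?thesis using Suc by (simp only: Q_def a_def)
  qed
  ultimately have A: "?A = (\<Sum>j<2 * n. x ^ triangle j) + U n" by (simp only: diff_0_right diff_eq_eq) (rule add.commute)
  \<comment> \<open>The term \<open>s = n\<close> of the new sum has no counterpart in the old one
    and is computed separately.\<close>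
  have L: "Q n (Suc n) * x ^ (n * (2 * Suc n + 1)) = r n * y ^ n * (x ^ (2 * n) - x ^ (2 * n) * y * x)"
  proof -
    have e: "x ^ (n * (2 * Suc n + 1)) = y ^ n * x ^ (2 * n)" "x ^ (2 * n + 2) = y * x"
      by (simp_all add: y_def power_mult[symmetric] power_add[symmetric] algebra_simps)
    have Q: "Q n (Suc n) = a n" by (simp add: Q_def)
    show ?thesis unfolding Q a_def e by (simp add: algebra_simps)
  qed
  have "(\<Sum>s<Suc n. Q s (Suc n) * x ^ (s * (2 * Suc n + 1))) =
     (\<Sum>j<2 * n. x ^ triangle j) + r n * y ^ n * (1 - x ^ (2 * n) * x * y)"
    unfolding sum.lessThan_Suc A L Un by (simp add: algebra_simps)
  also have "x ^ (2 * n) * x = y" by (simp add: y_def)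
  \<comment> \<open>The factor \<open>1 - y\<close> cancels against \<open>r n\<close>, which leaves
    exactly the two new powers, with indices \<open>2 * n\<close> and
    \<open>2 * n + 1\<close>.\<close>
  also have "r n * y ^ n * (1 - y * y) = ((1 - y) * r n) * (y ^ n * (1 + y))"
    by (simp add: algebra_simps)
  also have "\<dots> = y ^ n * (1 + y)" using r by (simp add: y_def)
  also have "\<dots> = x ^ triangle (2 * n) + x ^ triangle (2 * n + 1)"
  proof -
    have "triangle (2 * n) = (2 * n + 1) * n" by (simp add: triangle_def)
    moreover from this have "triangle (2 * n + 1) = (2 * n + 1) * n + (2 * n + 1)" by simp
    moreover have "x ^ ((2 * n + 1) * n + (2 * n + 1)) = y ^ n * y" "x ^ ((2 * n + 1) * n) = y ^ n"
      by (simp_all only: y_def power_mult power_add[of x "(2 * n + 1) * n"])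
    ultimately show ?thesis by (simp only: distrib_left mult_1_right)
  qed
  finally show ?case by (simp add: Q_def a_def)
qed simp

section \<open>The theta series of the triangular numbers\<close>

definition theta_fps :: "'a::comm_ring_1 fps" where
  "theta_fps = Abs_fps (\<lambda>n. of_bool (n \<in> range triangle))"

lemma strict_mono_triangle: "strict_mono triangle"
  by (rule strict_mono_Suc_iff[THEN iffD2]) simp

lemma inj_triangle: "inj triangle"
  using strict_mono_triangle by (rule strict_mono_imp_inj_on)

text \<open>Since \<open>j \<le> triangle j\<close>, a triangular number up to \<open>m\<close> has
  its index up to \<open>m\<close>; by injectivity it is counted once.\<close>

lemma theta_fps_nth_conv_sum:
  assumes "i \<le> m"
  shows "theta_fps $ i = (\<Sum>j<Suc m. fps_X ^ triangle j) $ i"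
proof -
  have "(\<Sum>j<Suc m. fps_X ^ triangle j :: 'a fps) $ i = (\<Sum>j<Suc m. if i = triangle j then 1 else 0)"
    by (simp add: fps_sum_nth)
  also have "\<dots> = (if i \<in> range triangle then 1 else 0)"
  proof (cases "i \<in> range triangle")
    case True
    then obtain l where l: "i = triangle l" by auto
    have "l \<le> i" using strict_mono_imp_increasing[OF strict_mono_triangle, of l] l by simp
    have "(\<Sum>j<Suc m. if i = triangle j then 1 else 0) = (\<Sum>j<Suc m. if j = l then 1 else (0::'a))"
      using inj_triangle by (intro sum.cong) (auto simp: l inj_eq)
    also have "\<dots> = 1" using \<open>l \<le> i\<close> assms by simp
    finally show ?thesis using True by simp
  qed (auto intro!: sum.neutral)
  finally show ?thesis by (simp add: theta_fps_def)
qed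

text \<open>In degrees up to \<open>2 * n\<close> only the term \<open>s = 0\<close> of Shanks' sum
  survives, so theta agrees there with the product of the quotients
  \<open>(1 - fps_X ^ (2 * k + 2)) / (1 - fps_X ^ (2 * k + 1))\<close>. Multiplication by the Euler
  product clears the odd factors and squares the even ones.\<close>

lemma theta_mult_euler:
  assumes "i \<le> 2 * n"
  shows "((theta_fps :: 'a::field fps) * euler_fps) $ i = ((\<Prod>k<n. 1 - fps_X ^ (2 * k + 2)) ^ 2) $ i"
proof -
  define r :: "nat \<Rightarrow> 'a fps" where "r k = inverse (1 - fps_X ^ (2 * k + 1))" for k
  have r: "(1 - fps_X ^ (2 * k + 1)) * r k = 1" for k
    unfolding r_def by (intro inverse_mult_eq_1') simp
  define Q where "Q s n = (\<Prod>k\<in>{s..<n}. (1 - fps_X ^ (2 * k + 2)) * r k)" for s n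
  have "theta_fps $ j = Q 0 n $ j" if "j \<le> i" for j
  \<comment> \<open>For \<open>n = 0\<close> the sum over \<open>s < n\<close> is empty and has no
    term \<open>s = 0\<close>; only the constant coefficient is then in question.\<close>
  proof (cases "n = 0")
    case True
    thus ?thesis using that assms by (simp add: theta_fps_def Q_def image_iff exI[of _ 0])
  next
    case False
    have "theta_fps $ j = (\<Sum>j<Suc (2 * n). fps_X ^ triangle j :: 'a fps) $ j"
      by (rule theta_fps_nth_conv_sum) (use that assms in auto)
    also have "\<dots> = (\<Sum>j<2 * n. fps_X ^ triangle j :: 'a fps) $ j"
    proof -
      have "triangle (2 * n) = (2 * n + 1) * n" by (simp add: triangle_def)
      moreover have "j < (2 * n + 1) * 1" using that assms by simp
      moreover have "(2 * n + 1) * 1 \<le> (2 * n + 1) * n" using False by (intro mult_le_mono2) auto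
      ultimately have "triangle (2 * n) > j" by (simp only: less_le_trans)
      thus ?thesis by simp
    qed
    also have "\<dots> = (\<Sum>s<n. Q s n * fps_X ^ (s * (2 * n + 1))) $ j"
      by (simp only: sum_triangle_powers[OF r] Q_def)
    also have "\<dots> = (\<Sum>s<n. (Q s n * fps_X ^ (s * (2 * n + 1))) $ j)"
      by (rule fps_sum_nth)
    also have "\<dots> = (\<Sum>s\<in>{0}. (Q s n * fps_X ^ (s * (2 * n + 1))) $ j)"
    proof (intro sum.mono_neutral_right ballI)
      fix s assume "s \<in> {..<n} - {0}"
      hence "1 * (2 * n + 1) \<le> s * (2 * n + 1)" by (intro mult_le_mono1) auto
      moreover have "j < 1 * (2 * n + 1)" using that assms by simp
      ultimately have "j < s * (2 * n + 1)" by (simp only: less_le_trans)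
      thus "(Q s n * fps_X ^ (s * (2 * n + 1))) $ j = 0"
        unfolding fps_X_power_mult_right_nth by simp
    qed (use False in auto)
    finally show ?thesis by simp
  qed
  moreover have "euler_fps $ j = euler_prod (2 * n) $ j" if "j \<le> i" for j
    by (rule euler_prod_nth[symmetric]) (use that assms in auto)
  ultimately have "((theta_fps :: 'a fps) * euler_fps) $ i = (Q 0 n * euler_prod (2 * n)) $ i"
    by (intro fps_mult_nth_cong) auto
  also have "Q 0 n * euler_prod (2 * n) = (\<Prod>k<n. 1 - fps_X ^ (2 * k + 2)) ^ 2"
  proof -
    have "euler_prod (2 * n) = (\<Prod>k<n. (1 - fps_X ^ (2 * k + 1)) * (1 - fps_X ^ (2 * k + 2)) :: 'a fps)"
      by (induction n) (simp_all add: euler_prod_def mult_ac)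
    hence "Q 0 n * euler_prod (2 * n) =
       (\<Prod>k<n. (1 - fps_X ^ (2 * k + 2)) * r k * ((1 - fps_X ^ (2 * k + 1)) * (1 - fps_X ^ (2 * k + 2))))"
      by (simp only: Q_def atLeast0LessThan prod.distrib)
    also have "\<dots> = (\<Prod>k<n. (1 - fps_X ^ (2 * k + 2)) ^ 2)"
    proof (intro prod.cong refl)
      fix k
      have "(1 - fps_X ^ (2 * k + 2)) * r k * ((1 - fps_X ^ (2 * k + 1)) * (1 - fps_X ^ (2 * k + 2)))
         = ((1 - fps_X ^ (2 * k + 1)) * r k) * (1 - fps_X ^ (2 * k + 2)) ^ 2"
        by (simp only: power2_eq_square mult_ac)
      thus "(1 - fps_X ^ (2 * k + 2)) * r k * ((1 - fps_X ^ (2 * k + 1)) * (1 - fps_X ^ (2 * k + 2)))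
         = (1 - fps_X ^ (2 * k + 2)) ^ 2" by (simp only: r mult_1_left)
    qed
    finally show ?thesis by (simp add: prod_power_distrib)
  qed
  finally show ?thesis .
qed

section \<open>Power series over the field with two elements\<close>

lemma bit_add_self: "x + x = (0 :: bit)"
  by (cases x) simp_all

lemma bit_fps_double: "F + F = (0 :: bit fps)"
  by (simp only: fps_eq_iff fps_add_nth fps_zero_nth bit_add_self) simp

text \<open>In the convolution the terms at \<open>k\<close> and \<open>n - k\<close> cancel in
  pairs. Only \<open>2 * k = n\<close> remains, where \<open>x * x = x\<close> in
  \<open>bit\<close>.\<close>

lemma bit_fps_square: "(F :: bit fps) ^ 2 = F oo fps_X ^ 2"
proof (rule fps_ext)
  fix n
  let ?t = "\<lambda>k. F $ k * F $ (n - k)"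
  have "{..n} = {k. 2 * k < n} \<union> ({k. n < 2 * k \<and> k \<le> n} \<union> {k. 2 * k = n})"
    by auto
  moreover have fin: "finite {k. 2 * k < n}" "finite {k. n < 2 * k \<and> k \<le> n}" "finite {k. 2 * k = n}"
    by (rule finite_subset[of _ "{..n}"]; force)+
  ultimately have "(F ^ 2) $ n = sum ?t {k. 2 * k < n} + (sum ?t {k. n < 2 * k \<and> k \<le> n} + sum ?t {k. 2 * k = n})"
    unfolding fps_square_nth by (simp only:) (subst sum.union_disjoint; (subst sum.union_disjoint)?; auto)
  also have "sum ?t {k. n < 2 * k \<and> k \<le> n} = sum ?t {k. 2 * k < n}"
    by (rule sum.reindex_bij_witness[of _ "\<lambda>k. n - k" "\<lambda>k. n - k"]) (auto simp del: mult_bit_eq_and simp: mult.commute)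
  also have "sum ?t {k. 2 * k < n} + (sum ?t {k. 2 * k < n} + sum ?t {k. 2 * k = n}) = sum ?t {k. 2 * k = n}"
    unfolding add.assoc[symmetric] bit_add_self by (rule add_0_left)
  also have "\<dots> = (F oo fps_X ^ 2) $ n"
  proof (cases "even n")
    case True
    hence "{k. 2 * k = n} = {n div 2}" by auto
    moreover have "n - n div 2 = n div 2" using True by auto
    moreover have "x * x = x" for x :: bit by (cases x) auto
    ultimately show ?thesis using True by (simp add: fps_nth_compose_X_power del: mult_bit_eq_and)
  next
    case False
    hence "{k. 2 * k = n} = {}" by auto
    thus ?thesis using False by (simp add: fps_nth_compose_X_power)
  qed
  finally show "(F ^ 2) $ n = (F oo fps_X ^ 2) $ n" .
qed

lemma fps_compose_X_power_X_power:
  fixes F :: "'a::field fps"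
  assumes "m > 0" "n > 0"
  shows "(F oo fps_X ^ m) oo fps_X ^ n = F oo fps_X ^ (m * n)"
proof (rule fps_ext)
  fix k
  have "m * n dvd k \<longleftrightarrow> n dvd k \<and> m dvd k div n"
    using assms by (metis dvd_div_iff_mult dvd_mult_right not_gr_zero)
  moreover have "k div n div m = k div (m * n)" by (metis div_mult2_eq mult.commute)
  ultimately show "((F oo fps_X ^ m) oo fps_X ^ n) $ k = (F oo fps_X ^ (m * n)) $ k"
    unfolding fps_nth_compose_X_power by presburger
qed

lemma bit_fps_power4: "(F :: bit fps) ^ 4 = F oo fps_X ^ 4"
proof -
  have "F ^ 4 = F ^ (2 * 2)" by simp
  also have "\<dots> = (F ^ 2) ^ 2" by (rule power_mult)
  also have "\<dots> = F ^ 2 oo fps_X ^ 2" by (rule bit_fps_square)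
  also have "\<dots> = (F oo fps_X ^ 2) oo fps_X ^ 2" by (rule arg_cong[OF bit_fps_square])
  also have "\<dots> = F oo fps_X ^ (2 * 2)" by (rule fps_compose_X_power_X_power) auto
  finally show ?thesis by simp
qed

text \<open>Jacobi's identity for the cube of the Euler product, read modulo 2. In characteristic 2
  each even factor is a square, \<open>1 - fps_X ^ (2 * m) = (1 - fps_X ^ m) ^ 2\<close>, so the
  right-hand side of \<open>theta_mult_euler\<close> becomes a fourth power; one factor
  \<open>euler_fps\<close> is then cancelled.\<close>

lemma theta_eq_euler_cubed: "(theta_fps :: bit fps) = euler_fps ^ 3"
proof -
  have sq: "1 - fps_X ^ (2 * k + 2) = (1 - fps_X ^ Suc k :: bit fps) ^ 2" for k
  proof -
    have "(1 - fps_X ^ Suc k :: bit fps) ^ 2 = 1 - (fps_X ^ Suc k + fps_X ^ Suc k) + (fps_X ^ Suc k) ^ 2"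
      by (simp add: power2_eq_square algebra_simps)
    also have "(fps_X ^ Suc k) ^ 2 = (fps_X ^ (2 * k + 2) :: bit fps)"
    proof -
      have "Suc k * 2 = 2 * k + 2" by simp
      thus ?thesis by (simp only: power_mult[symmetric])
    qed
    also have "\<dots> = - (fps_X ^ (2 * k + 2))" using bit_fps_double by (simp only: eq_neg_iff_add_eq_0)
    finally show ?thesis by (simp only: bit_fps_double) simp
  qed
  have "theta_fps * euler_fps = (euler_fps ^ 4 :: bit fps)"
  proof (rule fps_ext)
    fix i
    have "(theta_fps * euler_fps :: bit fps) $ i = ((\<Prod>k<i. 1 - fps_X ^ (2 * k + 2)) ^ 2) $ i"
      by (rule theta_mult_euler) simp
    also have "(\<Prod>k<i. 1 - fps_X ^ (2 * k + 2)) ^ 2 = (euler_prod i :: bit fps) ^ 4"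
      unfolding sq by (simp add: euler_prod_def prod_power_distrib flip: power_mult)
    also have "\<dots> $ i = (euler_fps ^ 4) $ i"
      by (rule fps_power_nth_cong[of i]) (auto simp: euler_prod_nth)
    finally show "(theta_fps * euler_fps :: bit fps) $ i = (euler_fps ^ 4) $ i" .
  qed
  also have "\<dots> = euler_fps ^ 3 * euler_fps" by (simp add: eval_nat_numeral)
  finally have *: "theta_fps * euler_fps = (euler_fps ^ 3 * euler_fps :: bit fps)" .
  have "(euler_fps :: bit fps) \<noteq> 0" by (metis euler_fps_0 fps_zero_nth zero_neq_one)
  with * show ?thesis by simp
qed

subsection \<open>Uniqueness and integrality of \<open>q\<close>-expansions\<close>

definition euler_fun :: "complex \<Rightarrow> complex" where
  "euler_fun q = (\<Prod>n. 1 - q ^ Suc n)"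

lemma convergent_prod_euler:
  fixes q :: complex
  assumes "norm q < 1"
  shows "convergent_prod (\<lambda>n. 1 - q ^ Suc n)"
proof (rule abs_convergent_prod_imp_convergent_prod)
  have "summable (\<lambda>n. norm q ^ Suc n)"
    using assms by (subst summable_Suc_iff) (auto intro!: summable_geometric)
  thus "abs_convergent_prod (\<lambda>n. 1 - q ^ Suc n)"
    by (simp add: abs_convergent_prod_conv_summable norm_mult norm_power)
qed

lemma euler_fun_nonzero:
  assumes "norm q < 1"
  shows "euler_fun q \<noteq> 0"
  unfolding euler_fun_def
proof (rule prodinf_nonzero[OF convergent_prod_euler[OF assms]])
  fix n
  have "norm (q ^ Suc n) < 1"
    using power_Suc_le_self[of "norm q" n] assms unfolding norm_power by simp
  thus "1 - q ^ Suc n \<noteq> 0" by force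
qed

text \<open>The M-test with bounds \<open>r ^ Suc n\<close> gives a uniform limit, which pointwise
  convergence identifies as \<open>euler_fun\<close>. Uniformity serves both holomorphy and the
  computation of Taylor coefficients.\<close>

lemma uniform_limit_euler:
  assumes "0 \<le> r" "r < 1"
  shows "uniform_limit (cball 0 r) (\<lambda>N q. \<Prod>k<N. 1 - q ^ Suc k) euler_fun sequentially"
proof -
  have "uniformly_convergent_on (cball 0 r) (\<lambda>N q. \<Prod>k<N. 1 - q ^ Suc k :: complex)"
  proof (rule uniformly_convergent_on_prod')
    show "uniformly_convergent_on (cball 0 r) (\<lambda>N q. \<Sum>n<N. norm (1 - q ^ Suc n - 1 :: complex))"
    proof (rule Weierstrass_m_test')
      fix n and q :: complex
      assume "q \<in> cball 0 r"
      hence "norm q ^ Suc n \<le> r ^ Suc n" by (intro power_mono) auto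
      thus "norm (norm (1 - q ^ Suc n - 1)) \<le> r ^ Suc n"
        by (simp add: norm_power norm_mult)
    next
      show "summable (\<lambda>n. r ^ Suc n)"
        using assms by (auto simp: summable_Suc_iff intro!: summable_geometric)
    qed
  qed (auto intro!: continuous_intros)
  then obtain g where g: "uniform_limit (cball 0 r) (\<lambda>N q. \<Prod>k<N. 1 - q ^ Suc k :: complex) g sequentially"
    by (auto simp: uniformly_convergent_on_def)
  also have "?this \<longleftrightarrow> ?thesis"
  proof (intro uniform_limit_cong)
    fix q :: complex assume q: "q \<in> cball 0 r"
    have "(\<lambda>n. \<Prod>k\<le>n. 1 - q ^ Suc k) \<longlonglongrightarrow> g q"
      using tendsto_uniform_limitI[OF g q] LIMSEQ_lessThan_iff_atMost by blast
    moreover have "(\<lambda>n. \<Prod>k\<le>n. 1 - q ^ Suc k) \<longlonglongrightarrow> euler_fun q"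
      unfolding euler_fun_def
      by (rule convergent_prod_LIMSEQ[OF convergent_prod_euler]) (use q assms in auto)
    ultimately show "g q = euler_fun q" by (rule LIMSEQ_unique)
  qed auto
  finally show ?thesis .
qed

lemma euler_fun_holomorphic: "euler_fun holomorphic_on ball 0 1"
proof (rule holomorphic_uniform_sequence)
  fix q :: complex assume "q \<in> ball 0 1"
  hence q: "norm q < 1" by simp
  \<comment> \<open>Half the distance from \<open>q\<close> to the unit circle, so that the closed
    disc about \<open>q\<close> stays inside one of radius
    \<open>(1 + norm q) / 2 < 1\<close>.\<close>
  define d where "d = (1 - norm q) / 2"
  have "cball q d \<subseteq> cball 0 ((1 + norm q) / 2)"
    using q by (auto simp: cball_subset_cball_iff d_def field_simps)
  hence "uniform_limit (cball q d) (\<lambda>N q. \<Prod>k<N. 1 - q ^ Suc k) euler_fun sequentially"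
    using q by (intro uniform_limit_on_subset[OF uniform_limit_euler]) auto
  moreover have "cball q d \<subseteq> ball 0 1"
    using q by (auto simp: cball_subset_ball_iff d_def field_simps)
  ultimately show "\<exists>d>0. cball q d \<subseteq> ball 0 1 \<and>
      uniform_limit (cball q d) (\<lambda>N q. \<Prod>k<N. 1 - q ^ Suc k) euler_fun sequentially"
    using q by (intro exI[of _ d]) (auto simp: d_def)
qed (auto intro!: holomorphic_intros)

text \<open>Under uniform convergence near 0 the Taylor coefficients are limits of those of the
  partial products, and these are eventually constant.\<close>

lemma euler_fun_has_fps_expansion: "euler_fun has_fps_expansion euler_fps"
proof -
  have ex: "euler_fun has_fps_expansion fps_expansion euler_fun 0"
    by (rule has_fps_expansion_fps_expansion[OF _ _ euler_fun_holomorphic]) auto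
  have "fps_expansion euler_fun 0 = euler_fps"
  proof (rule uniform_limit_imp_fps_expansion_eq)
    show "(euler_prod :: nat \<Rightarrow> complex fps) \<longlonglongrightarrow> euler_fps"
    proof (rule tendsto_fpsI)
      fix n
      show "\<forall>\<^sub>F N in sequentially. euler_prod N $ n = euler_fps $ n"
        using eventually_ge_at_top[of n] by eventually_elim (rule euler_prod_nth)
    qed
    show "uniform_limit (ball 0 (1/2)) (\<lambda>N q. \<Prod>k<N. 1 - q ^ Suc k) euler_fun sequentially"
      by (rule uniform_limit_on_subset[OF uniform_limit_euler[of "1/2"]]) auto
    show "\<forall>\<^sub>F N in sequentially. (\<lambda>q. \<Prod>k<N. 1 - q ^ Suc k) has_fps_expansion euler_prod N"
      unfolding euler_prod_def by (intro always_eventually allI fps_expansion_intros)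
    show "\<forall>\<^sub>F N in sequentially. (\<lambda>q. \<Prod>k<N. 1 - q ^ Suc k :: complex) holomorphic_on ball 0 (1/2)"
      by (intro always_eventually allI holomorphic_intros)
  qed (use ex in auto)
  with ex show ?thesis by simp
qed

section \<open>The nome and the coefficients of \<open>q\<close>-expansions\<close>

text \<open>A logarithm of \<open>w\<close> divided by \<open>2 \<pi> i\<close> has positive
  imaginary part because \<open>ln (norm w) < 0\<close>. Identities on the upper half-plane thus
  become identities on the punctured disc.\<close>

lemma nome_surj:
  assumes "w \<noteq> 0" "norm w < 1"
  obtains z where "Im z > 0" "nome z = w"
proof
  let ?z = "Ln w / (2 * of_real pi * \<i>)"
  show "nome ?z = w" using assms by (simp add: nome_def)
  have "Im ?z = - ln (norm w) / (2 * pi)"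
    using assms by (simp add: Im_divide power2_eq_square)
  moreover have "ln (norm w) < 0" using assms by simp
  ultimately show "Im ?z > 0" by (simp add: divide_neg_pos)
qed

lemma nome_nonzero [simp]: "nome z \<noteq> 0"
  by (simp add: nome_def)

lemma norm_nome_less_1: "Im z > 0 \<Longrightarrow> norm (nome z) < 1"
  by (simp add: nome_def)

text \<open>Multiplied by \<open>w powi (- N)\<close>, the difference of two expansions is a power
  series that vanishes on the punctured unit disc, hence has zero coefficients.\<close>

lemma has_q_expansion_unique:
  assumes a: "has_q_expansion f a" and b: "has_q_expansion f b"
  shows "a = b"
proof -
  obtain Na Nb where Na: "\<And>n. n < Na \<Longrightarrow> a n = 0" and Nb: "\<And>n. n < Nb \<Longrightarrow> b n = 0"
    using a b unfolding has_q_expansion_def by blast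
  define N where "N = min Na Nb"
  define d where "d n = a n - b n" for n
  have d0: "d n = 0" if "n < N" for n
    using that Na[of n] Nb[of n] by (simp add: d_def N_def)
  define D where "D = Abs_fps (\<lambda>k. d (N + int k))"
  have sums: "(\<lambda>k. D $ k * w ^ k) sums 0" if w: "w \<noteq> 0" "norm w < 1" for w
  proof -
    obtain z where z: "Im z > 0" "nome z = w" using nome_surj[OF w] .
    have "((\<lambda>n. a n * w powi n) has_sum f z) UNIV" "((\<lambda>n. b n * w powi n) has_sum f z) UNIV"
      using a b z unfolding has_q_expansion_def by auto
    from has_sum_add[OF this(1) has_sum_cmult_right[OF this(2), of "-1"]]
    have "((\<lambda>n. d n * w powi n) has_sum 0) UNIV" by (simp add: d_def algebra_simps)
    also have "?this \<longleftrightarrow> ((\<lambda>n. d n * w powi n) has_sum 0) {N..}"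
      by (rule has_sum_cong_neutral) (auto simp: d0)
    also have "\<dots> \<longleftrightarrow> ((\<lambda>k. d (N + int k) * w powi (N + int k)) has_sum 0) UNIV"
      by (rule has_sum_reindex_bij_witness[of _ "\<lambda>k. N + int k" "\<lambda>n. nat (n - N)"]) auto
    finally have "((\<lambda>k. w powi (- N) * (d (N + int k) * w powi (N + int k))) has_sum (w powi (- N) * 0)) UNIV"
      by (rule has_sum_cmult_right)
    hence "((\<lambda>k. D $ k * w ^ k) has_sum 0) UNIV"
      using w by (simp add: D_def power_int_add power_int_minus field_simps)
    thus ?thesis by (rule has_sum_imp_sums)
  qed
  \<comment> \<open>The point 0 is not a value of the nome, so the constant coefficient is obtained
    as a limit.\<close>
  have "((\<lambda>_. 0) \<longlongrightarrow> D $ 0) (at (0 :: complex))"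
    by (rule powser_limit_0_strong[of 1]) (use sums in auto)
  hence "D $ 0 = 0" by (rule tendsto_unique[OF at_neq_bot _ tendsto_const])
  have "(\<lambda>_. 0) has_fps_expansion D"
  proof (rule has_fps_expansionI)
    have "\<forall>\<^sub>F w in nhds 0. w \<in> ball (0 :: complex) 1"
      by (intro eventually_nhds_in_open) auto
    hence "\<forall>\<^sub>F w :: complex in nhds 0. norm w < 1" by simp
    thus "\<forall>\<^sub>F w in nhds 0. (\<lambda>k. D $ k * w ^ k) sums 0"
    proof eventually_elim
      case (elim w)
      show ?case
        using sums[OF _ elim] \<open>D $ 0 = 0\<close> powser_sums_zero[of "fps_nth D"] by (cases "w = 0") auto
    qed
  qed
  hence "D = 0" by (rule fps_expansion_unique_complex) simp
  have "d n = 0" for n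
  proof (cases "n < N")
    case False
    hence "d n = D $ nat (n - N)" by (simp add: D_def)
    thus ?thesis by (simp add: \<open>D = 0\<close>)
  qed (rule d0)
  thus ?thesis by (simp add: d_def fun_eq_iff)
qed

lemma q_coeff_eqI:
  assumes "has_q_expansion f (\<lambda>n. of_int (a n))"
  shows "q_coeff f = a"
  unfolding q_coeff_def
proof (rule the_equality)
  fix b assume "has_q_expansion f (\<lambda>n. of_int (b n))"
  from has_q_expansion_unique[OF this assms] show "b = a"
    by (simp add: fun_eq_iff)
qed (rule assms)

text \<open>The bridge from analysis to integral power series: holomorphy on the whole disc makes
  the Taylor series converge absolutely there, as \<open>has_sum\<close> demands, and
  \<open>m\<close> shifts the exponents.\<close>

lemma q_coeff_eq_fps_nth:
  fixes F :: "int fps" and m :: int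
  assumes hol: "f holomorphic_on ball 0 1"
    and exp: "f has_fps_expansion fps_of_int_fps F"
    and g: "\<And>z. Im z > 0 \<Longrightarrow> g z = nome z powi m * f (nome z)"
  shows "q_coeff g n = (if n < m then 0 else F $ nat (n - m))"
proof -
  define a where "a n = (if n < m then 0 else F $ nat (n - m))" for n
  have "has_q_expansion g (\<lambda>n. of_int (a n))"
    unfolding has_q_expansion_def
  proof (intro conjI allI impI)
    show "\<exists>N. \<forall>n<N. complex_of_int (a n) = 0"
      by (rule exI[of _ m]) (simp add: a_def)
  next
    fix z :: complex assume z: "Im z > 0"
    define q where "q = nome z"
    have q: "norm q < 1" "q \<noteq> 0" using norm_nome_less_1[OF z] by (auto simp: q_def)
    have hol': "f holomorphic_on eball 0 (ereal 1)" using hol by simp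
    have "summable (\<lambda>k. norm (fps_of_int_fps F $ k * q ^ k))"
      using holomorphic_on_imp_fps_conv_radius_ge[OF exp hol'] q
      by (intro norm_summable_fps) (auto intro: less_le_trans[of _ "ereal 1"])
    moreover have "(\<lambda>k. fps_of_int_fps F $ k * q ^ k) sums f q"
      using has_fps_expansion_imp_sums_complex[OF exp hol'] q by simp
    ultimately have "((\<lambda>k. fps_of_int_fps F $ k * q ^ k) has_sum f q) UNIV"
      by (rule norm_summable_imp_has_sum)
    hence "((\<lambda>k. q powi m * (fps_of_int_fps F $ k * q ^ k)) has_sum (q powi m * f q)) UNIV"
      by (rule has_sum_cmult_right)
    also have "?this \<longleftrightarrow> ((\<lambda>n. of_int (a n) * q powi n) has_sum (q powi m * f q)) {m..}"
    proof (rule has_sum_reindex_bij_witness[of _ "\<lambda>n. nat (n - m)" "\<lambda>k. m + int k"])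
      fix k
      show "of_int (a (m + int k)) * q powi (m + int k) = q powi m * (fps_of_int_fps F $ k * q ^ k)"
        using q by (simp add: a_def power_int_add)
    qed auto
    also have "\<dots> \<longleftrightarrow> ((\<lambda>n. of_int (a n) * q powi n) has_sum (q powi m * f q)) UNIV"
      by (rule has_sum_cong_neutral) (auto simp: a_def)
    finally show "((\<lambda>n. of_int (a n) * nome z powi n) has_sum g z) UNIV"
      by (simp add: g[OF z] q_def)
  qed
  hence "q_coeff g = a" by (rule q_coeff_eqI)
  thus ?thesis by (simp add: a_def)
qed

subsection \<open>Parity of the coefficients\<close>

lemma fps_of_int_fps_add: "fps_of_int_fps (F + G) = fps_of_int_fps F + fps_of_int_fps G"
  by (simp add: fps_eq_iff)

lemma fps_of_int_fps_numeral: "fps_of_int_fps (numeral k) = numeral k"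
  by (simp add: fps_eq_iff fps_numeral_nth)

text \<open>The constant coefficient 1 is a unit, so the inverse exists already over the integers;
  integrality is what allows reduction modulo 2.\<close>

definition inv_euler_fps :: "int fps" where
  "inv_euler_fps = fps_right_inverse euler_fps 1"

lemma euler_mult_inv_euler: "euler_fps * inv_euler_fps = 1"
  unfolding inv_euler_fps_def by (rule fps_right_inverse) simp

lemma fps_of_int_inv_euler: "fps_of_int_fps inv_euler_fps = (inverse euler_fps :: 'a::field fps)"
proof -
  have "euler_fps * fps_of_int_fps inv_euler_fps = (1 :: 'a fps)"
    by (metis euler_mult_inv_euler fps_of_int_euler fps_of_int_fps_1 fps_of_int_fps_mult)
  thus ?thesis by (metis fps_inverse_unique)
qed

text \<open>\<open>g_fps\<close> and \<open>inv_g_fps\<close> expand \<open>g3plus\<close> and its inverse without the factors \<open>q\<close> and \<open>q\<^sup>-\<^sup>1\<close>.\<close>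
definition g_fps :: "int fps" where
  "g_fps = ((euler_fps oo fps_X ^ 3) * inv_euler_fps) ^ 12"

definition inv_g_fps :: "int fps" where
  "inv_g_fps = (euler_fps * (inv_euler_fps oo fps_X ^ 3)) ^ 12"

lemma g_mult_inv_g: "g_fps * inv_g_fps = 1"
proof -
  have "(euler_fps oo fps_X ^ 3) * (inv_euler_fps oo fps_X ^ 3) = 1"
    by (simp add: fps_compose_mult_distrib[symmetric] euler_mult_inv_euler)
  moreover have "g_fps * inv_g_fps = (((euler_fps oo fps_X ^ 3) * (inv_euler_fps oo fps_X ^ 3))
      * (euler_fps * inv_euler_fps)) ^ 12"
    unfolding g_fps_def inv_g_fps_def power_mult_distrib[symmetric] by (simp only: mult_ac)
  ultimately show ?thesis by (simp add: euler_mult_inv_euler)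
qed

definition g_fun :: "complex \<Rightarrow> complex" where
  "g_fun q = (euler_fun (q ^ 3) * inverse (euler_fun q)) ^ 12"

definition inv_g_fun :: "complex \<Rightarrow> complex" where
  "inv_g_fun q = (euler_fun q * inverse (euler_fun (q ^ 3))) ^ 12"

lemma norm_power3_less_1: "norm (q :: complex) < 1 \<Longrightarrow> norm (q ^ 3) < 1"
  unfolding norm_power by (rule power_less_one_iff[THEN iffD2]) auto

lemma euler_fun_cube_holomorphic: "(\<lambda>q. euler_fun (q ^ 3)) holomorphic_on ball 0 1"
proof -
  have "euler_fun \<circ> (\<lambda>q. q ^ 3) holomorphic_on ball 0 1"
    by (rule holomorphic_on_compose_gen[OF _ euler_fun_holomorphic])
      (auto intro!: holomorphic_intros norm_power3_less_1 simp: norm_power3_less_1 simp del: norm_power)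
  thus ?thesis by (simp add: o_def)
qed

lemma g_fun_holomorphic: "g_fun holomorphic_on ball 0 1"
  unfolding g_fun_def
  by (intro holomorphic_intros euler_fun_cube_holomorphic euler_fun_holomorphic)
    (auto dest: euler_fun_nonzero)

lemma inv_g_fun_holomorphic: "inv_g_fun holomorphic_on ball 0 1"
  unfolding inv_g_fun_def
  by (intro holomorphic_intros euler_fun_cube_holomorphic euler_fun_holomorphic)
    (metis dist_0_norm euler_fun_nonzero mem_ball norm_power3_less_1)

lemma euler_fun_cube_has_fps_expansion:
  "(\<lambda>q. euler_fun (q ^ 3)) has_fps_expansion (euler_fps oo fps_X ^ 3)"
proof -
  have "(euler_fun \<circ> (\<lambda>q. q ^ 3)) has_fps_expansion (euler_fps oo fps_X ^ 3)"
    by (intro has_fps_expansion_compose euler_fun_has_fps_expansion fps_expansion_intros) auto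
  thus ?thesis by (simp add: o_def)
qed

lemma g_fun_has_fps_expansion: "g_fun has_fps_expansion fps_of_int_fps g_fps"
proof -
  have "fps_of_int_fps g_fps = ((euler_fps oo fps_X ^ 3) * inverse euler_fps :: complex fps) ^ 12"
    by (simp add: g_fps_def fps_of_int_fps_power fps_of_int_fps_mult fps_of_int_inv_euler
      fps_of_int_compose_X_power)
  thus ?thesis
    unfolding g_fun_def
    by (auto intro!: fps_expansion_intros euler_fun_cube_has_fps_expansion euler_fun_has_fps_expansion)
qed

lemma inv_g_fun_has_fps_expansion: "inv_g_fun has_fps_expansion fps_of_int_fps inv_g_fps"
proof -
  have "inverse euler_fps oo fps_X ^ 3 = (inverse (euler_fps oo fps_X ^ 3) :: complex fps)"
    by (rule fps_inverse_compose) auto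
  hence "fps_of_int_fps inv_g_fps = (euler_fps * inverse (euler_fps oo fps_X ^ 3) :: complex fps) ^ 12"
    by (simp add: inv_g_fps_def fps_of_int_fps_power fps_of_int_fps_mult fps_of_int_inv_euler
      fps_of_int_compose_X_power)
  thus ?thesis
    unfolding inv_g_fun_def
    by (auto intro!: fps_expansion_intros euler_fun_cube_has_fps_expansion euler_fun_has_fps_expansion)
qed

text \<open>The exponential prefactors leave \<open>exp (2 \<pi> i z / 12)\<close> in the quotient,
  and its twelfth power is \<open>nome z\<close>.\<close>

lemma eta_quotient_power:
  assumes "Im z > 0"
  shows "(dedekind_eta (3 * z) / dedekind_eta z) ^ 12 = nome z * g_fun (nome z)"
proof -
  have eta: "dedekind_eta w = exp (2 * of_real pi * \<i> * w / 24) * euler_fun (nome w)" for w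
    by (simp add: dedekind_eta_def euler_fun_def)
  have "nome (3 * z) = nome z ^ 3"
    unfolding nome_def exp_of_nat_mult[symmetric] by (simp add: mult_ac)
  moreover have "exp (2 * of_real pi * \<i> * (3 * z) / 24) =
      exp (2 * of_real pi * \<i> * z / 24) * exp (2 * of_real pi * \<i> * z / 12)"
    unfolding exp_add[symmetric] by (rule arg_cong[of _ _ exp]) (simp add: field_simps)
  ultimately have "dedekind_eta (3 * z) / dedekind_eta z =
      exp (2 * of_real pi * \<i> * z / 12) * (euler_fun (nome z ^ 3) * inverse (euler_fun (nome z)))"
    by (simp add: eta field_simps)
  moreover have "exp (2 * of_real pi * \<i> * z / 12) ^ 12 = nome z"
    unfolding nome_def exp_of_nat_mult[symmetric] by (simp add: mult_ac)
  ultimately show ?thesis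
    by (simp add: g_fun_def power_mult_distrib)
qed

lemma b3plus_eq: "b3plus n = (if n < 1 then 0 else g_fps $ nat (n - 1))"
  unfolding b3plus_def
  by (rule q_coeff_eq_fps_nth[OF g_fun_holomorphic g_fun_has_fps_expansion])
    (simp add: g3plus_def eta_quotient_power)

text \<open>Multiplying \<open>j3plus\<close> by \<open>q\<close> removes its pole, whence the shift
  by \<open>-1\<close>; the factor 729 is \<open>3 ^ 6\<close>.\<close>

lemma c3plus_eq:
  "c3plus n = (if n < -1 then 0
     else (inv_g_fps + 12 * fps_X ^ 1 + 729 * fps_X ^ 2 * g_fps) $ nat (n - (-1)))"
  unfolding c3plus_def
proof (rule q_coeff_eq_fps_nth)
  let ?f = "\<lambda>q. inv_g_fun q + 12 * q ^ 1 + 729 * q ^ 2 * g_fun q"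
  show "?f holomorphic_on ball 0 1"
    by (intro holomorphic_intros inv_g_fun_holomorphic g_fun_holomorphic)
  show "?f has_fps_expansion
      fps_of_int_fps (inv_g_fps + 12 * fps_X ^ 1 + 729 * fps_X ^ 2 * g_fps)"
    unfolding fps_of_int_fps_add fps_of_int_fps_mult fps_of_int_fps_X_power fps_of_int_fps_numeral
    by (intro fps_expansion_intros inv_g_fun_has_fps_expansion g_fun_has_fps_expansion)
  fix z assume z: "Im z > 0"
  have "(dedekind_eta z / dedekind_eta (3 * z)) ^ 12 = inverse ((dedekind_eta (3 * z) / dedekind_eta z) ^ 12)"
    by (simp flip: power_inverse)
  also have "\<dots> = inverse (nome z) * inv_g_fun (nome z)"
    unfolding eta_quotient_power[OF z] by (simp add: g_fun_def inv_g_fun_def field_simps)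
  finally show "j3plus z = nome z powi (- 1) * ?f (nome z)"
    unfolding j3plus_def eta_quotient_power[OF z]
    by (simp add: power_int_minus field_simps power2_eq_square)
qed

section \<open>Reduction of the expansions modulo 2\<close>

definition beta_fps :: "bit fps" where
  "beta_fps = (theta_fps oo fps_X ^ 3) * inverse theta_fps"

lemma theta_fps_0 [simp]: "theta_fps $ 0 = 1"
  by (simp add: theta_fps_def image_iff exI[of _ 0])

lemma theta_mult_beta: "theta_fps * beta_fps = theta_fps oo fps_X ^ 3"
proof -
  have "theta_fps * inverse theta_fps = (1 :: bit fps)"
    by (rule inverse_mult_eq_1') simp
  thus ?thesis by (simp add: beta_fps_def mult.left_commute)
qed

lemma beta_fps_0 [simp]: "beta_fps $ 0 = 1"
  by (simp add: beta_fps_def del: mult_bit_eq_and)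

text \<open>Over \<open>bit\<close>,
  \<open>euler_fps ^ 12 = theta_fps ^ 4 = theta_fps oo fps_X ^ 4\<close>. Both sides, multiplied by
  this nonzero series, give \<open>theta_fps oo fps_X ^ 12\<close>.\<close>

lemma g_fps_mod_2: "fps_of_int_fps g_fps = beta_fps oo fps_X ^ 4"
proof -
  have pow4: "(euler_fps :: bit fps) ^ 12 = theta_fps oo fps_X ^ 4"
  proof -
    have "(euler_fps :: bit fps) ^ 12 = euler_fps ^ (3 * 4)" by simp
    also have "\<dots> = theta_fps ^ 4" unfolding power_mult theta_eq_euler_cubed ..
    also have "\<dots> = theta_fps oo fps_X ^ 4" by (rule bit_fps_power4)
    finally show ?thesis .
  qed
  have "fps_of_int_fps g_fps * (theta_fps oo fps_X ^ 4) = (euler_fps ^ 12 oo fps_X ^ 3 :: bit fps)"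
  proof -
    have "inverse euler_fps * euler_fps = (1 :: bit fps)" by (rule inverse_mult_eq_1) simp
    hence "fps_of_int_fps g_fps * euler_fps ^ 12 = (euler_fps oo fps_X ^ 3 :: bit fps) ^ 12"
      unfolding g_fps_def fps_of_int_fps_power fps_of_int_fps_mult fps_of_int_inv_euler
        power_mult_distrib[symmetric] mult.assoc
      by (simp add: fps_of_int_compose_X_power)
    also have "\<dots> = euler_fps ^ 12 oo fps_X ^ 3" by (rule fps_compose_power) simp
    finally show ?thesis by (simp only: pow4)
  qed
  also have "\<dots> = (theta_fps oo fps_X ^ 3) oo fps_X ^ 4"
    unfolding pow4 by (simp add: fps_compose_X_power_X_power)
  also have "\<dots> = (beta_fps oo fps_X ^ 4) * (theta_fps oo fps_X ^ 4)"
    unfolding theta_mult_beta[symmetric]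
    by (subst fps_compose_mult_distrib) (simp_all add: mult.commute)
  finally have *: "fps_of_int_fps g_fps * (theta_fps oo fps_X ^ 4) = (beta_fps oo fps_X ^ 4) * (theta_fps oo fps_X ^ 4)" .
  have "(theta_fps oo fps_X ^ 4 :: bit fps) \<noteq> 0"
    by (metis fps_compose_nth_0 fps_zero_nth theta_fps_0 zero_neq_one)
  with * show ?thesis by simp
qed

lemma inv_g_fps_mod_2: "fps_of_int_fps inv_g_fps = inverse beta_fps oo fps_X ^ 4"
proof -
  have "fps_of_int_fps g_fps * fps_of_int_fps inv_g_fps = (1 :: bit fps)"
    unfolding fps_of_int_fps_mult[symmetric] g_mult_inv_g by simp
  hence "inverse (beta_fps oo fps_X ^ 4) = fps_of_int_fps inv_g_fps"
    unfolding g_fps_mod_2 by (rule fps_inverse_unique)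
  thus ?thesis by (subst fps_inverse_compose) auto
qed

lemma of_int_bit_eq_0_iff: "(of_int n :: bit) = 0 \<longleftrightarrow> even n"
proof (cases "even n")
  case True
  then obtain k where "n = 2 * k" by (elim evenE)
  thus ?thesis by simp
next
  case False
  then obtain k where "n = 2 * k + 1" by (elim oddE)
  thus ?thesis by simp
qed

lemma even_b3plus_iff: "even (b3plus (4 * int j + 1)) \<longleftrightarrow> beta_fps $ j = 0"
proof -
  have "(of_int (b3plus (4 * int j + 1)) :: bit) = fps_of_int_fps g_fps $ (4 * j)"
    by (simp add: b3plus_eq nat_mult_distrib)
  also have "\<dots> = beta_fps $ j"
    unfolding g_fps_mod_2 fps_nth_compose_X_power by simp
  finally show ?thesis using of_int_bit_eq_0_iff by metis
qed

text \<open>The exponent \<open>4 * j + 1\<close> sits at index \<open>4 * j + 2\<close> of the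
  shifted series. There the inverse part is even, since 4 does not divide the index, the term in 12
  lives at index 1 only, and 729 is odd; so the parity is that of \<open>b3plus\<close>.\<close>

lemma even_c3plus_iff: "even (c3plus (4 * int j + 1)) \<longleftrightarrow> beta_fps $ j = 0"
proof -
  have "nat (4 * int j + 1 - (-1)) = 4 * j + 2" by simp
  moreover have "(fps_X ^ 2 * g_fps) $ (4 * j + 2) = g_fps $ (4 * j)"
    unfolding fps_X_power_mult_nth by simp
  ultimately have "c3plus (4 * int j + 1) = inv_g_fps $ (4 * j + 2) + 729 * g_fps $ (4 * j)"
    by (simp add: c3plus_eq mult.assoc fps_mult_numeral_left fps_numeral_nth)
  moreover have "(of_int (inv_g_fps $ (4 * j + 2)) :: bit) = 0"
  proof -
    have "\<not> 4 dvd (4 * j + 2)" by presburger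
    hence "fps_of_int_fps inv_g_fps $ (4 * j + 2) = (0 :: bit)"
      unfolding inv_g_fps_mod_2 fps_nth_compose_X_power by simp
    thus ?thesis by simp
  qed
  moreover have "b3plus (4 * int j + 1) = g_fps $ (4 * j)"
    by (simp add: b3plus_eq nat_mult_distrib)
  ultimately show ?thesis
    using even_b3plus_iff[of j] by (simp add: of_int_bit_eq_0_iff)
qed

section \<open>Comparing coefficients at triangular numbers\<close>

text \<open>By hypothesis \<open>theta_fps oo fps_X ^ 3\<close> has coefficient 0 at
  \<open>triangle t\<close>. In the convolution the index \<open>l = t\<close> contributes
  \<open>beta_fps $ 0 = 1\<close>, so the remaining terms add up to 1.\<close>

lemma sum_beta_eq_1:
  assumes "\<nexists>l. t * (t + 1) = 3 * l * (l + 1)"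
  shows "(\<Sum>l<t. beta_fps $ (triangle t - triangle l)) = 1"
proof -
  let ?f = "\<lambda>i. beta_fps $ (triangle t - i)"
  have "(theta_fps * beta_fps) $ triangle t = (\<Sum>i\<le>triangle t. theta_fps $ i * ?f i)"
    by (simp only: fps_mult_nth atLeast0AtMost)
  \<comment> \<open>The theta coefficients vanish off the triangular numbers, and those up to
    \<open>triangle t\<close> have index at most \<open>t\<close>.\<close>
  also have "\<dots> = (\<Sum>i\<in>triangle ` {..t}. theta_fps $ i * ?f i)"
  proof (rule sum.mono_neutral_right)
    show "triangle ` {..t} \<subseteq> {..triangle t}"
      using strict_mono_triangle by (auto simp: strict_mono_less_eq)
    show "\<forall>i\<in>{..triangle t} - triangle ` {..t}. theta_fps $ i * ?f i = 0"
      using strict_mono_less_eq[OF strict_mono_triangle] by (auto simp: theta_fps_def)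
  qed auto
  also have "\<dots> = (\<Sum>i\<in>triangle ` {..t}. ?f i)"
    by (rule sum.cong) (auto simp: theta_fps_def)
  also have "\<dots> = (\<Sum>l\<le>t. ?f (triangle l))"
    by (subst sum.reindex) (auto intro: inj_on_subset[OF inj_triangle])
  also have "\<dots> = (\<Sum>l<t. ?f (triangle l)) + 1"
    unfolding lessThan_Suc_atMost[symmetric] sum.lessThan_Suc by simp
  also have "(theta_fps * beta_fps) $ triangle t = 0"
  proof -
    have "triangle t \<noteq> 3 * triangle l" for l
    proof
      assume "triangle t = 3 * triangle l"
      moreover have "2 * triangle m = m * (m + 1)" for m by (simp add: triangle_def)
      ultimately have "t * (t + 1) = 3 * (l * (l + 1))" by (metis mult.left_commute)
      thus False using assms by (metis mult.assoc)
    qed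
    hence "\<not> (3 dvd triangle t \<and> triangle t div 3 \<in> range triangle)" by (metis dvd_mult_div_cancel imageE)
    thus ?thesis unfolding theta_mult_beta fps_nth_compose_X_power by (auto simp: theta_fps_def)
  qed
  finally show ?thesis by (cases "\<Sum>l<t. ?f (triangle l)") auto
qed

text \<open>The smallest difference occurs at \<open>l = t - 1\<close> and equals \<open>t\<close>.
  These bounds become the endpoints of the intervals under \<open>n = 4 * j + 1\<close>.\<close>

lemma triangle_diff_bounds:
  assumes "l < t"
  shows "t \<le> triangle t - triangle l" "triangle t - triangle l \<le> triangle t"
proof -
  obtain m where m: "t = Suc m" using assms by (cases t) auto
  have "triangle l \<le> triangle m" using assms m strict_mono_less_eq[OF strict_mono_triangle] by auto
  thus "t \<le> triangle t - triangle l" by (simp add: m)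
qed simp

lemma ex_beta_eq_1:
  assumes "\<nexists>l. t * (t + 1) = 3 * l * (l + 1)"
  obtains j where "t \<le> j" "j \<le> triangle t" "beta_fps $ j = 1"
proof -
  have "\<exists>l<t. beta_fps $ (triangle t - triangle l) \<noteq> 0"
    using sum_beta_eq_1[OF assms] by (metis lessThan_iff sum.neutral zero_neq_one)
  then obtain l where "l < t" "beta_fps $ (triangle t - triangle l) = 1" by auto
  thus ?thesis using triangle_diff_bounds by (intro that)
qed

text \<open>If all \<open>t\<close> summands were 1, their sum would be the residue of the even
  number \<open>t\<close>, hence 0 instead of 1.\<close>

lemma ex_beta_eq_0:
  assumes "\<nexists>l. t * (t + 1) = 3 * l * (l + 1)" "even t"
  obtains j where "t \<le> j" "j \<le> triangle t" "beta_fps $ j = 0"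
proof -
  have "\<exists>l<t. beta_fps $ (triangle t - triangle l) \<noteq> 1"
  proof (rule ccontr)
    assume "\<not> ?thesis"
    hence "(\<Sum>l<t. beta_fps $ (triangle t - triangle l)) = (\<Sum>l<t. 1)" by (intro sum.cong) auto
    also have "\<dots> = of_int (int t)" by simp
    also have "\<dots> = 0" using assms(2) unfolding of_int_bit_eq_0_iff by simp
    finally show False using sum_beta_eq_1[OF assms(1)] by simp
  qed
  then obtain l where "l < t" "beta_fps $ (triangle t - triangle l) = 0" by auto
  thus ?thesis using triangle_diff_bounds by (intro that)
qed

text \<open>Here \<open>t * (t + 1)\<close> is 2 modulo 3. This supplies admissible \<open>t\<close>
  of arbitrary size for the two infinitude claims.\<close>

lemma no_triple_pronic:
  assumes "t mod 3 = 1"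
  shows "\<nexists>l :: nat. t * (t + 1) = 3 * l * (l + 1)"
proof
  assume "\<exists>l. t * (t + 1) = 3 * l * (l + 1)"
  hence "t * (t + 1) mod 3 = 0" by (auto simp: mult.assoc)
  moreover have "t * (t + 1) mod 3 = (t mod 3) * ((t + 1) mod 3) mod 3" by (rule mod_mult_eq[symmetric])
  moreover have "(t + 1) mod 3 = 2" using assms by presburger
  ultimately show False by (simp add: assms)
qed

lemma infinite_int_if_unbounded:
  assumes "\<And>k :: nat. \<exists>n\<in>S. int k < n"
  shows "infinite (S :: int set)"
proof
  assume "finite S"
  obtain n where "n \<in> S" "int (nat (Max S)) < n" using assms by blast
  moreover from this \<open>finite S\<close> have "n \<le> Max S" by simp
  ultimately show False by linarith
qed

theorem theorem3p2:
  shows "(\<forall>t::nat. t > 0 \<longrightarrow> (\<nexists>l::nat. t * (t + 1) = 3 * l * (l + 1)) \<longrightarrow>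
            (\<exists>n \<in> {4 * int t + 1 .. 2 * int t * (int t + 1) + 1}.
               [n = 1] (mod 4) \<and> odd (b3plus n)))
       \<and> (\<forall>t::nat. t > 0 \<longrightarrow> (\<nexists>l::nat. 2 * t * (2 * t + 1) = 3 * l * (l + 1)) \<longrightarrow>
            (\<exists>n \<in> {8 * int t + 1 .. 4 * int t * (2 * int t + 1) + 1}.
               [n = 1] (mod 4) \<and> even (b3plus n)))
       \<and> infinite {n::int. n > 0 \<and> [n = 1] (mod 4) \<and> even (c3plus n)}
       \<and> infinite {n::int. n > 0 \<and> [n = 1] (mod 4) \<and> odd (c3plus n)}"
proof (intro conjI allI impI)
  have cong: "[4 * int j + 1 = 1] (mod 4)" for j by (simp add: cong_def)
  \<comment> \<open>Turns the bound \<open>j \<le> triangle t\<close> into the upper endpoint for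
    \<open>4 * j + 1\<close>.\<close>
  have triangle: "4 * int (triangle t) = 2 * int t * (int t + 1)" for t
  proof -
    have "2 * triangle t = t * (t + 1)" by (simp add: triangle_def)
    hence "int (2 * triangle t) = int (t * (t + 1))" by (rule arg_cong)
    hence "2 * int (triangle t) = int t * (int t + 1)" by (simp add: distrib_left)
    thus ?thesis by simp
  qed
  show "\<exists>n \<in> {4 * int t + 1 .. 2 * int t * (int t + 1) + 1}. [n = 1] (mod 4) \<and> odd (b3plus n)"
    if h: "\<nexists>l::nat. t * (t + 1) = 3 * l * (l + 1)" for t
  proof -
    obtain j where j: "t \<le> j" "j \<le> triangle t" "beta_fps $ j = 1" using ex_beta_eq_1[OF h] .
    hence "4 * int j \<le> 2 * int t * (int t + 1)" unfolding triangle[symmetric] by simp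
    with j show ?thesis
      by (intro bexI[of _ "4 * int j + 1"] conjI cong) (simp_all add: even_b3plus_iff)
  qed
  show "\<exists>n \<in> {8 * int t + 1 .. 4 * int t * (2 * int t + 1) + 1}. [n = 1] (mod 4) \<and> even (b3plus n)"
    if h: "\<nexists>l::nat. 2 * t * (2 * t + 1) = 3 * l * (l + 1)" for t
  proof -
    \<comment> \<open>The even case is applied with \<open>2 * t\<close> in the role of
      \<open>t\<close>.\<close>
    have "even (2 * t)" by simp
    with ex_beta_eq_0[OF h] obtain j where
      j: "2 * t \<le> j" "j \<le> triangle (2 * t)" "beta_fps $ j = 0" .
    hence "4 * int j \<le> 4 * int t * (2 * int t + 1)" using triangle[of "2 * t"] by simp
    with j show ?thesis
      by (intro bexI[of _ "4 * int j + 1"] conjI cong) (simp_all add: even_b3plus_iff)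
  qed
  show "infinite {n::int. n > 0 \<and> [n = 1] (mod 4) \<and> even (c3plus n)}"
  proof (rule infinite_int_if_unbounded)
    fix k :: nat
    \<comment> \<open>Chosen to be even, congruent to 1 modulo 3 and larger than
      \<open>k\<close>.\<close>
    define t where "t = 6 * k + 4"
    have "t mod 3 = 1" "even t" unfolding t_def by presburger+
    then obtain j where "t \<le> j" "beta_fps $ j = 0"
      using ex_beta_eq_0[OF no_triple_pronic] by blast
    thus "\<exists>n\<in>{n. n > 0 \<and> [n = 1] (mod 4) \<and> even (c3plus n)}. int k < n"
      by (intro bexI[of _ "4 * int j + 1"]) (auto simp: cong even_c3plus_iff t_def)
  qed
  show "infinite {n::int. n > 0 \<and> [n = 1] (mod 4) \<and> odd (c3plus n)}"
  proof (rule infinite_int_if_unbounded)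
    fix k :: nat
    \<comment> \<open>An odd coefficient exists for either parity of \<open>t\<close>, so only the
      residue modulo 3 matters.\<close>
    define t where "t = 3 * k + 1"
    have "t mod 3 = 1" unfolding t_def by presburger
    then obtain j where "t \<le> j" "beta_fps $ j = 1"
      using ex_beta_eq_1[OF no_triple_pronic] by blast
    thus "\<exists>n\<in>{n. n > 0 \<and> [n = 1] (mod 4) \<and> odd (c3plus n)}. int k < n"
      by (intro bexI[of _ "4 * int j + 1"]) (auto simp: cong even_c3plus_iff t_def)
  qed
qed

end
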